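(* Let $f:\mathbb{R}^d\to\mathbb{R}$ be strictly convex and $T:\mathbb{R}^d\to\mathbb{R}^d$ firmly nonexpansive with $\mathrm{Fix}\,T\neq\emptyset$, and assume that the solution set $\mathcal{S}$ of the problem of minimizing $f$ over $\mathrm{Fix}\,T$ is nonempty. Let $\tau\in\mathbb{N}_0$ and let $\{\tau_n\}_{n=0}^\infty\subset\mathbb{N}_0$ satisfy $0\le\tau_n\le\tau$ for all $n\in\mathbb{N}_0$. Let $\{\alpha_n\}_{n=0}^\infty\subset(0,\infty)$ satisfy $\lim_{n\to\infty}\alpha_n=0$ and $\sum_{n=0}^\infty\alpha_n=\infty$. Let $\{\mathbf{x}_n\}$ be generated by the Fixed-Point Delayed Subgradient Method: $\mathbf{x}_0=\mathbf{x}_{-1}=\cdots=\mathbf{x}_{-\tau}\in\mathbb{R}^d$ and $$\mathbf{x}_{n+1}=T\mathbf{x}_n-\alpha_n\widetilde{\nabla}f(T\mathbf{x}_{n-\tau_n}),\qquad n\in\mathbb{N}_0.$$ Suppose that there exists $M>0$ such that $\|\mathbf{x}_n\|\le M$ for all $n\in\mathbb{N}_0$. Then the problem of minimizing $f$ over $\mathrm{Fix}\,T$ has a unique optimal solution and the whole sequence $\{\mathbf{x}_n\}_{n=0}^\infty$ converges to it.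
   Context: $\mathbb{R}^d$ is Euclidean space with inner product $\langle\cdot,\cdot\rangle$ and induced norm $\|\cdot\|$; $\mathbb{N}_0$ is the set of nonnegative integers. $T$ is firmly nonexpansive if $\langle T\mathbf{x}-T\mathbf{y},\mathbf{x}-\mathbf{y}\rangle\ge\|T\mathbf{x}-T\mathbf{y}\|^2$ for all $\mathbf{x},\mathbf{y}\in\mathbb{R}^d$. $\mathrm{Fix}\,T=\{\mathbf{x}\in\mathbb{R}^d:T\mathbf{x}=\mathbf{x}\}$. $\mathcal{S}$ is the set of minimizers of $f$ over $\mathrm{Fix}\,T$. For each $\mathbf{x}\in\mathbb{R}^d$, $\widetilde{\nabla}f(\mathbf{x})$ denotes a (chosen) subgradient of $f$ at $\mathbf{x}$, i.e. an element of $\partial f(\mathbf{x})=\{\mathbf{g}\in\mathbb{R}^d:\langle\mathbf{g},\mathbf{y}-\mathbf{x}\rangle\le f(\mathbf{y})-f(\mathbf{x})\ \forall\mathbf{y}\in\mathbb{R}^d\}$. *)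

theory Defs
  imports "HOL-Analysis.Analysis"
begin

definition strictly_convex_on :: "'a::real_vector set \<Rightarrow> ('a \<Rightarrow> real) \<Rightarrow> bool" where
  "strictly_convex_on S f \<longleftrightarrow> convex S \<and>
     (\<forall>x\<in>S. \<forall>y\<in>S. \<forall>t. x \<noteq> y \<longrightarrow> 0 < t \<longrightarrow> t < 1 \<longrightarrow>
        f ((1 - t) *\<^sub>R x + t *\<^sub>R y) < (1 - t) * f x + t * f y)"

definition firmly_nonexpansive :: "('a::real_inner \<Rightarrow> 'a) \<Rightarrow> bool" where
  "firmly_nonexpansive T \<longleftrightarrow> (\<forall>x y. (T x - T y) \<bullet> (x - y) \<ge> (norm (T x - T y))\<^sup>2)"

definition Fix :: "('a \<Rightarrow> 'a) \<Rightarrow> 'a set" where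
  "Fix T = {x. T x = x}"

definition subdifferential :: "('a::real_inner \<Rightarrow> real) \<Rightarrow> 'a \<Rightarrow> 'a set" where
  "subdifferential f x = {g. \<forall>y. g \<bullet> (y - x) \<le> f y - f x}"

definition minimizers :: "('a \<Rightarrow> real) \<Rightarrow> 'a set \<Rightarrow> 'a set" where
  "minimizers f C = {x. is_arg_min f (\<lambda>y. y \<in> C) x}"

text \<open>
  The iterates are indexed by the integers, because the delayed index \<open>n - \<tau>\<^sub>n\<close> may be negative;
  only indices \<open>\<ge> -\<tau>\<close> are constrained. The map \<open>g\<close> is the chosen subgradient selection.
\<close>

definition fixed_point_delayed_subgradient ::
  "('a::real_vector \<Rightarrow> 'a) \<Rightarrow> ('a \<Rightarrow> 'a) \<Rightarrow> nat \<Rightarrow> (nat \<Rightarrow> nat) \<Rightarrow> (nat \<Rightarrow> real) \<Rightarrow> (int \<Rightarrow> 'a) \<Rightarrow> bool" where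
  "fixed_point_delayed_subgradient T g \<tau> delay \<alpha> x \<longleftrightarrow>
     (\<forall>k\<in>{- int \<tau>..0}. x k = x 0) \<and>
     (\<forall>n. x (int n + 1) = T (x (int n)) - \<alpha> n *\<^sub>R g (T (x (int n - int (delay n)))))"

end

theory Submission
  imports Defs
begin

text \<open>
  Let \<open>z\<close> be the minimizer (unique, since the fixed points of a firmly nonexpansive map contain
  the midpoint of any two of them and \<open>f\<close> is strictly convex), let \<open>y n\<close> be the iterates, and
  let \<open>r n = norm (T (y n) - y n)\<close> be the residuals. The subgradients are taken
  on a bounded set, hence bounded by some \<open>K\<close>. Without the delay, firm nonexpansiveness and
  the subgradient inequality give
  \[ \|y_{n+1} - z\|^2 \le \|y_n - z\|^2 - r_n^2 + 2 \alpha_n (f(z) - f(y_n) + K r_n + \alpha_n K^2). \]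
  The delay adds a term \<open>2 K norm (w n - T (y n))\<close> inside the bracket, where \<open>w n\<close> is the point at
  which the subgradient is taken; let \<open>E n\<close> be the bracket with this term. The gap from \<open>w n\<close>
  to \<open>T (y n)\<close> is at most the length of the last \<open>\<tau>\<close> steps, hence is controlled by the last \<open>\<tau>\<close> residuals and step sizes
  (\<open>delayed_subgradient_step\<close>, \<open>delay_gap_le_memory\<close>).

  The step sizes tend to \<open>0\<close>, but no rate is known for the residuals: a single large residual
  decreases the distance to \<open>z\<close> at its own step, while it spoils the subgradient direction at the
  following \<open>\<tau>\<close> steps. The remedy is to spread its gain over these later steps. The function
  \<open>V n = (norm (y n - z))\<^sup>2 + S n\<close>, where \<open>S\<close> is an exponentially decaying memory of the squared
  residuals, satisfies
  \[ V_{n+1} \le V_n - \tfrac34 r_n^2 - \tfrac12 S_n + 2 \alpha_n E_n, \]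
  with \<open>E n\<close> bounded above. Suppose now that \<open>V n \<ge> \<eta>\<close> and that \<open>n\<close> is large. If \<open>r n\<close> or \<open>S n\<close>
  exceeds a fixed threshold, then \<open>V\<close> drops by a fixed amount, which outweighs any fixed multiple
  of \<open>\<alpha> n\<close>. Otherwise \<open>y n\<close> is almost fixed by \<open>T\<close> and still far from \<open>z\<close>, so by compactness
  \<open>f (y n)\<close> exceeds \<open>f z\<close> by a fixed margin (\<open>residual_or_value_gap\<close>), and \<open>E n\<close> is
  negative, bounded away from \<open>0\<close>. In both cases \<open>V\<close> drops by at least a fixed multiple of \<open>\<alpha> n\<close>.
  As \<open>\<alpha>\<close> has a divergent sum, \<open>V\<close> must fall below \<open>\<eta>\<close>, and it cannot climb back beyond an
  arbitrarily small overshoot (\<open>tendsto_0_of_conditional_descent\<close>). Hence \<open>V\<close> tends to \<open>0\<close>.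
\<close>

section \<open>Firmly nonexpansive maps and strict convexity\<close>

lemma firmly_nonexpansive_nonexpansive:
  assumes "firmly_nonexpansive T"
  shows "norm (T x - T y) \<le> norm (x - y)"
proof (cases "T x = T y")
  case False
  have "(norm (T x - T y))\<^sup>2 \<le> (T x - T y) \<bullet> (x - y)"
    using assms by (simp add: firmly_nonexpansive_def)
  also have "\<dots> \<le> norm (T x - T y) * norm (x - y)"
    by (rule norm_cauchy_schwarz)
  finally show ?thesis
    using False by (simp add: power2_eq_square)
qed simp

lemma firmly_nonexpansive_continuous_on:
  assumes "firmly_nonexpansive T"
  shows "continuous_on S T"
proof (rule lipschitz_on_continuous_on)
  show "1-lipschitz_on S T"
    using firmly_nonexpansive_nonexpansive[OF assms] by (simp add: lipschitz_on_def dist_norm)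
qed

text \<open>
  Substituting \<open>x - p = (x - T x) + (T x - p)\<close> in the definition cancels the squared norm: the
  segments from \<open>T x\<close> to \<open>x\<close> and to a fixed point \<open>p\<close> meet at an angle of at least ninety degrees,
  as for the projection onto a convex set.
\<close>

lemma firmly_nonexpansive_Fix_obtuse:
  assumes "firmly_nonexpansive T" and "p \<in> Fix T"
  shows "0 \<le> (T x - p) \<bullet> (x - T x)"
proof -
  have "(norm (T x - p))\<^sup>2 \<le> (T x - p) \<bullet> (x - p)"
    using assms(1)[unfolded firmly_nonexpansive_def, rule_format, where x = x and y = p] assms(2)
    by (simp add: Fix_def)
  then show ?thesis
    by (simp add: power2_norm_eq_inner inner_diff_left inner_diff_right inner_commute)
qed

lemma firmly_nonexpansive_Fix_Pythagoras:
  assumes "firmly_nonexpansive T" and "p \<in> Fix T"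
  shows "(norm (T x - p))\<^sup>2 \<le> (norm (x - p))\<^sup>2 - (norm (T x - x))\<^sup>2"
  using firmly_nonexpansive_Fix_obtuse[OF assms, of x]
  by (simp add: power2_norm_eq_inner inner_diff_left inner_diff_right inner_commute)

text \<open>
  At the midpoint \<open>m\<close> the obtuse-angle inequalities for \<open>p\<close> and \<open>q\<close> add up to
  \<open>- 2 * (norm (m - T m))\<^sup>2 \<ge> 0\<close>.
\<close>

lemma firmly_nonexpansive_midpoint_Fix:
  assumes T: "firmly_nonexpansive T" and p: "p \<in> Fix T" and q: "q \<in> Fix T"
  shows "midpoint p q \<in> Fix T"
proof -
  define m where "m = midpoint p q"
  have pq: "p + q = 2 *\<^sub>R m"
    by (simp add: m_def midpoint_def)
  have "0 \<le> (T m - p) \<bullet> (m - T m) + (T m - q) \<bullet> (m - T m)"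
    using firmly_nonexpansive_Fix_obtuse[OF T p, of m] firmly_nonexpansive_Fix_obtuse[OF T q, of m]
    by linarith
  also have "\<dots> = (2 *\<^sub>R T m - (p + q)) \<bullet> (m - T m)"
    by (simp add: inner_diff_left inner_add_left algebra_simps)
  also have "\<dots> = - 2 * ((m - T m) \<bullet> (m - T m))"
    by (simp add: pq inner_diff_left inner_diff_right inner_commute)
  finally have "(m - T m) \<bullet> (m - T m) \<le> 0" by simp
  then have "(m - T m) \<bullet> (m - T m) = 0" by (rule order.antisym[OF _ inner_ge_zero])
  then have "m = T m" by simp
  then show ?thesis by (simp add: Fix_def m_def)
qed

lemma strictly_convex_minimizers_Fix_unique:
  assumes f: "strictly_convex_on UNIV f" and T: "firmly_nonexpansive T"
    and p: "p \<in> minimizers f (Fix T)" and q: "q \<in> minimizers f (Fix T)"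
  shows "p = q"
proof (rule ccontr)
  assume "p \<noteq> q"
  have pF: "p \<in> Fix T" and qF: "q \<in> Fix T" and pq: "f p = f q"
    and least: "\<And>y. y \<in> Fix T \<Longrightarrow> f p \<le> f y"
    using p q by (auto simp: minimizers_def is_arg_min_linorder intro: antisym)
  have m: "midpoint p q = (1 - 1/2) *\<^sub>R p + (1/2) *\<^sub>R q"
    by (simp add: midpoint_def scaleR_add_right)
  have "f (midpoint p q) < (1 - 1/2) * f p + (1/2) * f q"
    unfolding m
    by (rule f[unfolded strictly_convex_on_def, THEN conjunct2, rule_format]) (use \<open>p \<noteq> q\<close> in auto)
  moreover have "f p \<le> f (midpoint p q)"
    by (rule least[OF firmly_nonexpansive_midpoint_Fix[OF T pF qF]])
  ultimately show False using pq by simp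
qed

lemma strictly_convex_on_imp_convex_on:
  assumes "strictly_convex_on S f"
  shows "convex_on S f"
proof (rule convex_onI)
  fix t :: real and x y assume *: "0 < t" "t < 1" "x \<in> S" "y \<in> S"
  show "f ((1 - t) *\<^sub>R x + t *\<^sub>R y) \<le> (1 - t) * f x + t * f y"
  proof (cases "x = y")
    case True
    then show ?thesis by (simp add: algebra_simps flip: scaleR_add_left)
  next
    case False
    then show ?thesis using assms * unfolding strictly_convex_on_def by (meson less_imp_le)
  qed
qed (use assms in \<open>simp add: strictly_convex_on_def\<close>)

section \<open>The one-step inequality\<close>

text \<open>
  Moving from \<open>y\<close> by a unit step in the direction of \<open>g y\<close> raises \<open>f\<close> by at least \<open>norm (g y)\<close>,
  and \<open>f\<close> is bounded on the ball of radius \<open>R + 1\<close>.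
\<close>

lemma subgradients_bounded_on_cball:
  fixes f :: "'a::euclidean_space \<Rightarrow> real"
  assumes cont: "continuous_on UNIV f" and g: "\<And>y. g y \<in> subdifferential f y"
  shows "\<exists>K>0. \<forall>y\<in>cball 0 R. norm (g y) \<le> K"
proof -
  have "compact (f ` cball 0 (R + 1))"
    by (intro compact_continuous_image continuous_on_subset[OF cont]) auto
  then obtain B where B: "\<And>y. y \<in> cball 0 (R + 1) \<Longrightarrow> \<bar>f y\<bar> \<le> B"
    using compact_imp_bounded bounded_real by (metis imageI)
  have "norm (g y) \<le> 2 * \<bar>B\<bar> + 1" if y: "y \<in> cball 0 R" for y
  proof (cases "g y = 0")
    case False
    define y' where "y' = y + sgn (g y)"
    have "norm y' \<le> norm y + norm (sgn (g y))"
      unfolding y'_def by (rule norm_triangle_ineq)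
    then have y': "y' \<in> cball 0 (R + 1)"
      using y False by (simp add: norm_sgn)
    have "norm (g y) = g y \<bullet> (y' - y)"
      using False
      by (simp add: y'_def sgn_div_norm power2_eq_square flip: power2_norm_eq_inner)
    also have "\<dots> \<le> f y' - f y"
      using g[of y] by (simp add: subdifferential_def)
    also have "\<dots> \<le> 2 * \<bar>B\<bar> + 1"
      using B[OF y'] B[of y] y by (auto simp: abs_le_iff)
    finally show ?thesis .
  qed simp
  then show ?thesis by (intro exI[of _ "2 * \<bar>B\<bar> + 1"]) auto
qed

lemma subgradient_decrease_le:
  assumes "g \<in> subdifferential f x" and "norm g \<le> K"
  shows "f x - f y \<le> K * norm (y - x)"
proof -
  have "f x - f y \<le> g \<bullet> (x - y)"
    using assms(1) by (simp add: subdifferential_def inner_diff_right) (smt (verit))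
  also have "\<dots> \<le> norm g * norm (x - y)" by (rule norm_cauchy_schwarz)
  also have "\<dots> \<le> K * norm (y - x)"
    using assms(2) by (simp add: norm_minus_commute mult_right_mono)
  finally show ?thesis .
qed

text \<open>
  The subgradient is taken at \<open>w\<close> but the point moved is \<open>T u\<close>. The gap \<open>norm (w - T u)\<close>
  is paid twice, once for the inner product and once for replacing \<open>f w\<close> by \<open>f (T u)\<close>; replacing
  \<open>f (T u)\<close> by \<open>f u\<close> costs the residual.
\<close>

lemma delayed_subgradient_step:
  assumes T: "firmly_nonexpansive T" and z: "z \<in> Fix T" and a: "0 \<le> a"
    and g: "\<And>y. g y \<in> subdifferential f y"
    and K: "norm (g w) \<le> K" "norm (g (T u)) \<le> K" "norm (g u) \<le> K"
  shows "(norm (T u - a *\<^sub>R g w - z))\<^sup>2 \<le> (norm (u - z))\<^sup>2 - (norm (T u - u))\<^sup>2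
    + 2 * a * (f z - f u + K * norm (T u - u) + 2 * K * norm (w - T u) + a * K\<^sup>2)"
proof -
  have "g w \<bullet> (z - T u) = g w \<bullet> (z - w) + g w \<bullet> (w - T u)"
    by (simp add: inner_diff_right)
  also have "\<dots> \<le> (f z - f w) + K * norm (w - T u)"
  proof (rule add_mono)
    show "g w \<bullet> (z - w) \<le> f z - f w"
      using g[of w] by (simp add: subdifferential_def)
    have "g w \<bullet> (w - T u) \<le> norm (g w) * norm (w - T u)" by (rule norm_cauchy_schwarz)
    also have "\<dots> \<le> K * norm (w - T u)" using K(1) by (simp add: mult_right_mono)
    finally show "g w \<bullet> (w - T u) \<le> K * norm (w - T u)" .
  qed
  also have "\<dots> \<le> f z - f u + K * norm (T u - u) + 2 * K * norm (w - T u)"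
    using subgradient_decrease_le[OF g K(2), of w] subgradient_decrease_le[OF g K(3), of "T u"]
    by linarith
  finally have lin: "g w \<bullet> (z - T u) \<le>
    f z - f u + K * norm (T u - u) + 2 * K * norm (w - T u)" .
  have "(norm (g w))\<^sup>2 \<le> K\<^sup>2" using K(1) by (simp add: power_mono)
  then have "a\<^sup>2 * (norm (g w))\<^sup>2 \<le> a\<^sup>2 * K\<^sup>2" by (simp add: mult_left_mono)
  also have "\<dots> \<le> 2 * (a * a * K\<^sup>2)"
    using zero_le_power2[of "a * K"] by (simp add: power2_eq_square algebra_simps)
  finally have quad: "a\<^sup>2 * (norm (g w))\<^sup>2 \<le> 2 * (a * a * K\<^sup>2)" .
  have "(norm (T u - a *\<^sub>R g w - z))\<^sup>2
      = (norm (T u - z))\<^sup>2 + 2 * a * (g w \<bullet> (z - T u)) + a\<^sup>2 * (norm (g w))\<^sup>2"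
    unfolding power2_norm_eq_inner
    by (simp add: inner_diff_left inner_diff_right inner_commute power2_eq_square algebra_simps)
  also have "\<dots> \<le> ((norm (u - z))\<^sup>2 - (norm (T u - u))\<^sup>2)
      + 2 * a * (f z - f u + K * norm (T u - u) + 2 * K * norm (w - T u))
      + 2 * (a * a * K\<^sup>2)"
    using firmly_nonexpansive_Fix_Pythagoras[OF T z, of u] mult_left_mono[OF lin, of "2 * a"] a quad
    by simp
  finally show ?thesis by (simp add: algebra_simps)
qed

section \<open>Controlling the delay by past residuals\<close>

text \<open>
  The sum over \<open>k < n\<close> of \<open>(r k)\<^sup>2 / 2 ^ (n + 1 - k)\<close>. The geometric weights make every
  bounded window of past residuals visible in the current value, while each step gives back half
  of what is stored. The factor \<open>1/4\<close> spends only a part of the decrease \<open>(r n)\<^sup>2\<close> that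
  a step of the method yields.
\<close>

primrec decaying_memory :: "(nat \<Rightarrow> real) \<Rightarrow> nat \<Rightarrow> real" where
  "decaying_memory r 0 = 0"
| "decaying_memory r (Suc n) = decaying_memory r n / 2 + (r n)\<^sup>2 / 4"

lemma decaying_memory_nonneg: "0 \<le> decaying_memory r n"
  by (induction n) auto

lemma decaying_memory_controls_past:
  assumes "j < n"
  shows "(r (n - Suc j))\<^sup>2 \<le> 4 * 2 ^ j * decaying_memory r n"
  using assms
proof (induction n arbitrary: j)
  case (Suc n)
  show ?case
  proof (cases j)
    case 0
    then show ?thesis using decaying_memory_nonneg[of r n] by simp
  next
    case (Suc i)
    have "(r (n - Suc i))\<^sup>2 \<le> 4 * 2 ^ i * decaying_memory r n"
      using Suc Suc.IH[of i] Suc.prems by simp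
    also have "\<dots> \<le> 4 * 2 ^ i * (decaying_memory r n + (r n)\<^sup>2 / 2)"
      by (rule mult_left_mono) auto
    also have "\<dots> = 4 * 2 ^ Suc i * decaying_memory r (Suc n)"
      by (simp add: field_simps)
    finally show ?thesis using Suc by simp
  qed
qed simp

lemma norm_diff_le_sum_backward_steps:
  fixes y :: "nat \<Rightarrow> 'a::real_normed_vector"
  assumes "i \<le> n"
  shows "norm (y (n - i) - y n) \<le> (\<Sum>j<i. norm (y (Suc (n - Suc j)) - y (n - Suc j)))"
  using assms
proof (induction i)
  case (Suc i)
  have e: "Suc (n - Suc i) = n - i" using Suc.prems by simp
  have "norm (y (n - Suc i) - y n)
      \<le> norm (y (n - i) - y n) + norm (y (n - i) - y (n - Suc i))"
    using dist_triangle3[of "y (n - Suc i)" "y n" "y (n - i)"]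
    by (simp add: dist_norm add.commute)
  then show ?case using Suc by (simp add: e)
qed simp

text \<open>
  Each of the last \<open>\<tau>\<close> residuals is at most \<open>sqrt (4 * 2 ^ \<tau>)\<close> times the square root of the
  memory. The condition \<open>2 * \<tau> \<le> n\<close> ensures that the window of \<open>\<tau>\<close> steps before \<open>n\<close> only
  contains indices from \<open>\<tau>\<close> on, where the step bound is available.
\<close>

lemma delay_gap_le_memory:
  fixes y :: "nat \<Rightarrow> 'a::real_normed_vector"
  assumes steps: "\<And>k. k \<ge> \<tau> \<Longrightarrow> norm (y (Suc k) - y k) \<le> r k + e k"
    and r: "\<And>k. 0 \<le> r k" and e: "\<And>k. 0 \<le> e k" and i: "i \<le> \<tau>" and n: "2 * \<tau> \<le> n"
  shows "norm (y (n - i) - y n) \<le>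
    real \<tau> * sqrt (4 * 2 ^ \<tau>) * sqrt (decaying_memory r n) + (\<Sum>j<\<tau>. e (n - Suc j))"
proof -
  let ?S = "decaying_memory r n"
  have past: "r (n - Suc j) \<le> sqrt (4 * 2 ^ \<tau>) * sqrt ?S" if "j < \<tau>" for j
  proof -
    have "(r (n - Suc j))\<^sup>2 \<le> 4 * 2 ^ j * ?S"
      using that n by (intro decaying_memory_controls_past) auto
    also have "\<dots> \<le> 4 * 2 ^ \<tau> * ?S"
      using that by (intro mult_right_mono decaying_memory_nonneg) (auto intro: power_increasing)
    finally show ?thesis
      by (simp only: real_le_rsqrt flip: real_sqrt_mult)
  qed
  have "norm (y (n - i) - y n) \<le> (\<Sum>j<i. norm (y (Suc (n - Suc j)) - y (n - Suc j)))"
    using i n by (intro norm_diff_le_sum_backward_steps) auto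
  also have "\<dots> \<le> (\<Sum>j<\<tau>. norm (y (Suc (n - Suc j)) - y (n - Suc j)))"
    using i by (intro sum_mono2) auto
  also have "\<dots> \<le> (\<Sum>j<\<tau>. sqrt (4 * 2 ^ \<tau>) * sqrt ?S + e (n - Suc j))"
  proof (rule sum_mono)
    fix j assume j: "j \<in> {..<\<tau>}"
    have "norm (y (Suc (n - Suc j)) - y (n - Suc j)) \<le> r (n - Suc j) + e (n - Suc j)"
      using j n by (intro steps) auto
    then show "norm (y (Suc (n - Suc j)) - y (n - Suc j))
        \<le> sqrt (4 * 2 ^ \<tau>) * sqrt ?S + e (n - Suc j)"
      using past[of j] j by simp
  qed
  finally show ?thesis by (simp add: sum.distrib)
qed

section \<open>Convergence\<close>

text \<open>
  A descent by \<open>\<delta> * \<alpha> n\<close> at every late step would exhaust \<open>V\<close>, because the partial sums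
  of \<open>\<alpha>\<close> are unbounded; so \<open>V\<close> falls below each level \<open>\<eta>\<close>. From then on \<open>V\<close> can rise only
  from below \<open>\<eta>\<close>, and by less than \<open>\<eta>\<close> in one step.
\<close>

lemma tendsto_0_of_conditional_descent:
  fixes V \<alpha> e :: "nat \<Rightarrow> real"
  assumes V: "\<And>n. 0 \<le> V n"
    and div: "filterlim (\<lambda>N. \<Sum>n<N. \<alpha> n) at_top sequentially"
    and \<alpha>: "\<And>n. 0 < \<alpha> n"
    and e: "e \<longlonglongrightarrow> 0" and step: "eventually (\<lambda>n. V (Suc n) \<le> V n + e n) sequentially"
    and descent: "\<And>\<eta>. \<eta> > 0 \<Longrightarrow>
      \<exists>\<delta>>0. eventually (\<lambda>n. \<eta> \<le> V n \<longrightarrow> V (Suc n) \<le> V n - \<delta> * \<alpha> n) sequentially"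
  shows "V \<longlonglongrightarrow> 0"
proof (rule order_tendstoI)
  fix c :: real assume "c < 0"
  then show "eventually (\<lambda>n. c < V n) sequentially"
    using V by (intro always_eventually allI) (rule less_le_trans)
next
  fix c :: real assume c: "0 < c"
  obtain \<delta> where \<delta>: "\<delta> > 0"
    and ev: "eventually (\<lambda>n. c/2 \<le> V n \<longrightarrow> V (Suc n) \<le> V n - \<delta> * \<alpha> n) sequentially"
    using descent[of "c/2"] c by auto
  have "eventually (\<lambda>n. e n < c/2) sequentially"
    using order_tendstoD(2)[OF e, of "c/2"] c by simp
  from eventually_conj[OF ev eventually_conj[OF step this]]
  obtain N where desc: "\<And>n. n \<ge> N \<Longrightarrow> c/2 \<le> V n \<Longrightarrow> V (Suc n) \<le> V n - \<delta> * \<alpha> n"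
    and jump: "\<And>n. n \<ge> N \<Longrightarrow> V (Suc n) < V n + c/2"
    unfolding eventually_sequentially by (meson add_strict_left_mono le_less_trans)
  have "\<exists>m\<ge>N. V m < c/2"
  proof (rule ccontr)
    assume "\<not> ?thesis"
    then have large: "c/2 \<le> V n" if "n \<ge> N" for n using that by force
    have *: "V n + \<delta> * (\<Sum>k<n. \<alpha> k) \<le> V N + \<delta> * (\<Sum>k<N. \<alpha> k)" if "n \<ge> N" for n
      using that
    proof (induction n rule: dec_induct)
      case (step n)
      then show ?case using desc[of n] large[of n] by (simp add: algebra_simps)
    qed simp
    have bound: "(\<Sum>k<n. \<alpha> k) \<le> (V N + \<delta> * (\<Sum>k<N. \<alpha> k)) / \<delta>" if "n \<ge> N" for n
      using *[OF that] V[of n] \<delta> by (simp add: pos_le_divide_eq mult.commute)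
    have "eventually (\<lambda>n. (V N + \<delta> * (\<Sum>k<N. \<alpha> k)) / \<delta> < (\<Sum>k<n. \<alpha> k)) sequentially"
      using div by (simp add: filterlim_at_top_dense)
    then obtain n where "n \<ge> N" "(V N + \<delta> * (\<Sum>k<N. \<alpha> k)) / \<delta> < (\<Sum>k<n. \<alpha> k)"
      unfolding eventually_sequentially by (meson nle_le order_refl)
    with bound show False by force
  qed
  then obtain m where m: "m \<ge> N" "V m < c/2" by auto
  have "V n < c" if "n \<ge> m" for n
    using that
  proof (induction n rule: dec_induct)
    case (step n)
    have n: "n \<ge> N" using step m by simp
    show ?case
    proof (cases "c/2 \<le> V n")
      case True
      have "0 < \<delta> * \<alpha> n" using \<delta> \<alpha> by simp
      then show ?thesis using desc[OF n True] step by linarith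
    next
      case False
      then show ?thesis using jump[OF n] by linarith
    qed
  qed (use m c in linarith)
  then show "eventually (\<lambda>n. V n < c) sequentially"
    unfolding eventually_sequentially by blast
qed

text \<open>
  Among points at a distance from \<open>z\<close>, the residual and the excess \<open>f x - f z\<close> cannot
  both be nonpositive, since such a point would be a competing minimizer. So their maximum is
  a positive continuous function, bounded below on a compact set.
\<close>

lemma residual_or_value_gap:
  fixes f :: "'a::real_normed_vector \<Rightarrow> real"
  assumes C: "compact C" and f: "continuous_on C f" and T: "continuous_on C T"
    and unique: "\<And>x. x \<in> Fix T \<Longrightarrow> f x \<le> f z \<Longrightarrow> x = z" and \<eta>: "\<eta> > 0"
  shows "\<exists>\<theta>>0. \<forall>x\<in>C. \<eta> \<le> (norm (x - z))\<^sup>2 \<longrightarrow> norm (T x - x) \<le> \<theta> \<longrightarrow> f z + \<theta> \<le> f x"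
proof -
  define D where "D = C \<inter> {x. \<eta> \<le> (norm (x - z))\<^sup>2}"
  have "closed {x. \<eta> \<le> (norm (x - z))\<^sup>2}"
    by (intro closed_Collect_le continuous_intros)
  then have D: "compact D"
    unfolding D_def using C by (rule compact_Int_closed[rotated])
  show ?thesis
  proof (cases "D = {}")
    case True
    then show ?thesis by (intro exI[of _ 1]) (auto simp: D_def)
  next
    case False
    define h where "h x = max (norm (T x - x)) (f x - f z)" for x
    have "continuous_on D h"
      unfolding h_def
      by (intro continuous_intros continuous_on_subset[OF f] continuous_on_subset[OF T])
        (auto simp: D_def)
    then obtain p where p: "p \<in> D" and least: "\<And>x. x \<in> D \<Longrightarrow> h p \<le> h x"
      using continuous_attains_inf[OF D False] by blast
    have "0 < h p"
    proof (rule ccontr)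
      assume "\<not> 0 < h p"
      then have "norm (T p - p) \<le> 0" "f p \<le> f z" by (simp_all only: h_def not_less max.bounded_iff) auto
      then have "p = z" using unique by (simp add: Fix_def)
      then show False using p \<eta> by (simp add: D_def)
    qed
    moreover have "f z + h p / 2 \<le> f x"
      if "x \<in> C" "\<eta> \<le> (norm (x - z))\<^sup>2" "norm (T x - x) \<le> h p / 2" for x
    proof -
      have "h p \<le> h x" using least that by (simp add: D_def)
      then have "h p \<le> f x - f z"
        using that(3) \<open>0 < h p\<close> unfolding h_def[of x] by linarith
      then show ?thesis using \<open>0 < h p\<close> by linarith
    qed
    ultimately show ?thesis by (intro exI[of _ "h p / 2"]) auto
  qed
qed

text \<open>
  The recursion is required from index \<open>\<tau>\<close> on, where the delayed index is a natural
  number, so that the prehistory of the iteration need not be modelled.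
\<close>

lemma bounded_delayed_subgradient_iterates_tendsto:
  fixes f :: "'a::euclidean_space \<Rightarrow> real" and y :: "nat \<Rightarrow> 'a"
  assumes cont: "continuous_on UNIV f" and T: "firmly_nonexpansive T"
    and z: "z \<in> Fix T" and unique: "\<And>x. x \<in> Fix T \<Longrightarrow> f x \<le> f z \<Longrightarrow> x = z"
    and g: "\<And>y. g y \<in> subdifferential f y"
    and delay: "\<And>n. delay n \<le> \<tau>"
    and \<alpha>: "\<And>n. 0 < \<alpha> n" and \<alpha>0: "\<alpha> \<longlonglongrightarrow> 0"
    and div: "filterlim (\<lambda>N. \<Sum>n<N. \<alpha> n) at_top sequentially"
    and rec: "\<And>n. n \<ge> \<tau> \<Longrightarrow> y (Suc n) = T (y n) - \<alpha> n *\<^sub>R g (T (y (n - delay n)))"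
    and M: "\<And>n. norm (y n) \<le> M"
  shows "y \<longlonglongrightarrow> z"
proof -
  define R where "R = M + 2 * norm z"
  have M0: "0 \<le> M" using M[of 0] norm_ge_zero order_trans by blast
  have Ty: "norm (T (y n)) \<le> R" for n
  proof -
    have Tz: "T z = z" using z by (simp add: Fix_def)
    have "norm (T (y n)) \<le> norm (T (y n) - T z) + norm (T z)"
      using norm_triangle_sub[of "T (y n)" "T z"] by linarith
    also have "\<dots> \<le> norm (y n - z) + norm z"
      using firmly_nonexpansive_nonexpansive[OF T, of "y n" z] by (simp add: Tz)
    also have "\<dots> \<le> R"
      using norm_triangle_ineq4[of "y n" z] M[of n] by (simp add: R_def)
    finally show ?thesis .
  qed
  obtain K where K0: "K > 0" and K: "\<And>u. norm u \<le> R \<Longrightarrow> norm (g u) \<le> K"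
    using subgradients_bounded_on_cball[OF cont g, of R] by auto
  have yR: "norm (y n) \<le> R" for n using M[of n] by (simp add: R_def add_increasing2)
  have zR: "norm z \<le> R" using M0 by (simp add: R_def)

  define r where "r n = norm (T (y n) - y n)" for n
  define w where "w n = T (y (n - delay n))" for n
  define S where "S = decaying_memory r"
  define V where "V n = (norm (y n - z))\<^sup>2 + S n" for n
  define E where "E n = f z - f (y n) + K * r n + 2 * K * norm (w n - T (y n)) + \<alpha> n * K\<^sup>2" for n
  define b where "b n = (\<Sum>j<\<tau>. K * \<alpha> (n - Suc j))" for n
  define L where "L = real \<tau> * sqrt (4 * 2 ^ \<tau>)"
  have r0: "0 \<le> r n" for n by (simp add: r_def)
  have S0: "0 \<le> S n" for n by (simp add: S_def decaying_memory_nonneg)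
  have L0: "0 \<le> L" by (simp add: L_def)
  have V0: "0 \<le> V n" for n using S0 by (simp add: V_def)

  have b_lim: "b \<longlonglongrightarrow> 0"
  proof -
    have "(\<lambda>n. \<Sum>j<\<tau>. K * \<alpha> (n - Suc j)) \<longlonglongrightarrow> (\<Sum>j<\<tau>. K * 0)"
      by (intro tendsto_sum tendsto_mult tendsto_const
          filterlim_compose[OF \<alpha>0 filterlim_minus_const_nat_at_top])
    then show ?thesis by (simp add: b_def[abs_def])
  qed

  have gap_norm: "norm (w n - T (y n)) \<le> norm (y (n - delay n) - y n)" for n
    unfolding w_def by (rule firmly_nonexpansive_nonexpansive[OF T])
  have gap: "norm (w n - T (y n)) \<le> L * sqrt (S n) + b n" if n: "n \<ge> 2 * \<tau>" for n
  proof -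
    have steps: "norm (y (Suc k) - y k) \<le> r k + K * \<alpha> k" if "k \<ge> \<tau>" for k
    proof -
      have "y (Suc k) - y k = (T (y k) - y k) - \<alpha> k *\<^sub>R g (w k)"
        using rec[OF that] by (simp add: w_def)
      then have "norm (y (Suc k) - y k) \<le> r k + norm (\<alpha> k *\<^sub>R g (w k))"
        unfolding r_def by (metis norm_triangle_ineq4)
      moreover have "norm (\<alpha> k *\<^sub>R g (w k)) \<le> K * \<alpha> k"
        using K[of "w k"] Ty \<alpha>[of k] by (simp add: w_def mult.commute[of K] mult_left_mono)
      ultimately show ?thesis by linarith
    qed
    have "norm (y (n - delay n) - y n) \<le> L * sqrt (S n) + b n"
      unfolding L_def S_def b_def
      by (rule delay_gap_le_memory[where e = "\<lambda>k. K * \<alpha> k", OF steps r0 _ delay n])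
        (use K0 \<alpha> less_imp_le in \<open>auto simp: less_imp_le\<close>)
    with gap_norm[of n] show ?thesis by linarith
  qed

  have V_step: "V (Suc n) \<le> V n - 3/4 * (r n)\<^sup>2 - S n / 2 + 2 * \<alpha> n * E n" if "n \<ge> \<tau>" for n
  proof -
    have "(norm (y (Suc n) - z))\<^sup>2 \<le> (norm (y n - z))\<^sup>2 - (r n)\<^sup>2 + 2 * \<alpha> n * E n"
      unfolding rec[OF that] r_def E_def w_def
      by (rule delayed_subgradient_step[OF T z _ g])
        (use K Ty yR \<alpha> in \<open>auto simp: less_imp_le\<close>)
    moreover have "S (Suc n) = S n / 2 + (r n)\<^sup>2 / 4" by (simp add: S_def)
    ultimately show ?thesis by (simp add: V_def)
  qed

  \<comment> \<open>One summand for each of the four positive contributions to \<open>E\<close>, once the step sizes are below \<open>1\<close>.\<close>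
  define B where "B = K * (2 * R) + K * (2 * R) + 2 * K * (2 * M) + K\<^sup>2"
  have B0: "0 \<le> B" using K0 M0 by (simp add: B_def R_def)
  have \<alpha>1: "eventually (\<lambda>n. \<alpha> n < 1) sequentially"
    using order_tendstoD(2)[OF \<alpha>0] by simp
  have E_le: "E n \<le> B" if "\<alpha> n < 1" for n
  proof -
    have "f z - f (y n) \<le> K * norm (y n - z)"
      by (rule subgradient_decrease_le[OF g K[OF zR]])
    also have "\<dots> \<le> K * (2 * R)"
      using norm_triangle_ineq4[of "y n" z] yR[of n] zR K0 by (intro mult_left_mono) auto
    finally have 1: "f z - f (y n) \<le> K * (2 * R)" .
    have 2: "K * r n \<le> K * (2 * R)"
      using norm_triangle_ineq4[of "T (y n)" "y n"] yR[of n] Ty[of n] K0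
      by (intro mult_left_mono) (auto simp: r_def)
    have 3: "2 * K * norm (w n - T (y n)) \<le> 2 * K * (2 * M)"
      using gap_norm[of n] norm_triangle_ineq4[of "y (n - delay n)" "y n"]
        M[of n] M[of "n - delay n"] K0
      by (intro mult_left_mono) auto
    have 4: "\<alpha> n * K\<^sup>2 \<le> K\<^sup>2" using that by (simp add: mult_left_le_one_le \<alpha> less_imp_le)
    show ?thesis unfolding E_def B_def using 1 2 3 4 by linarith
  qed

  have "V \<longlonglongrightarrow> 0"
  proof (rule tendsto_0_of_conditional_descent[where \<alpha> = \<alpha> and e = "\<lambda>n. 2 * \<alpha> n * B"])
    show "(\<lambda>n. 2 * \<alpha> n * B) \<longlonglongrightarrow> 0"
      using tendsto_mult[OF tendsto_mult[OF tendsto_const[of 2] \<alpha>0] tendsto_const[of B]] by simp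
    show "eventually (\<lambda>n. V (Suc n) \<le> V n + 2 * \<alpha> n * B) sequentially"
      using \<alpha>1 eventually_ge_at_top[of \<tau>]
    proof eventually_elim
      case (elim n)
      have "2 * \<alpha> n * E n \<le> 2 * \<alpha> n * B"
        using E_le[OF elim(1)] \<alpha>[of n] by (intro mult_left_mono) auto
      then show ?case using V_step[OF elim(2)] S0[of n] zero_le_power2[of "r n"] by linarith
    qed
  next
    fix \<eta> :: real assume \<eta>: "\<eta> > 0"
    obtain \<theta> where \<theta>0: "\<theta> > 0"
      and \<theta>: "\<And>u. norm u \<le> R \<Longrightarrow> \<eta>/2 \<le> (norm (u - z))\<^sup>2 \<Longrightarrow> norm (T u - u) \<le> \<theta> \<Longrightarrow> f z + \<theta> \<le> f u"
      using residual_or_value_gap[of "cball 0 R" f T z "\<eta>/2"] \<eta> unique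
        continuous_on_subset[OF cont] firmly_nonexpansive_continuous_on[OF T] by auto
    \<comment> \<open>The thresholds for the residual and the memory are such that below them (and for late \<open>n\<close>)
      the error terms in \<open>E\<close> consume at most half of the margin \<open>\<theta>\<close>, and \<open>V \<ge> \<eta>\<close> forces the
      distance part of \<open>V\<close> to be at least \<open>\<eta>/2\<close>. Dividing by \<open>L + 1\<close> covers the case \<open>L = 0\<close>.\<close>
    define \<rho> where "\<rho> = min \<theta> (\<theta> / (8 * K))"
    define \<sigma> where "\<sigma> = min (\<eta>/2) ((\<theta> / (16 * K * (L + 1)))\<^sup>2)"
    define \<kappa> where "\<kappa> = min (3/4 * \<rho>\<^sup>2) (\<sigma>/2)"
    have \<rho>0: "0 < \<rho>" using \<theta>0 K0 by (simp add: \<rho>_def)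
    have \<sigma>0: "0 < \<sigma>" using \<theta>0 K0 L0 \<eta> by (simp add: \<sigma>_def)
    have \<kappa>0: "0 < \<kappa>" using \<rho>0 \<sigma>0 by (simp add: \<kappa>_def)
    have "eventually (\<lambda>n. \<alpha> n < \<theta> / (8 * K\<^sup>2)) sequentially"
      "eventually (\<lambda>n. \<alpha> n < \<kappa> / (2 * B + \<theta>)) sequentially"
      "eventually (\<lambda>n. b n < \<theta> / (16 * K)) sequentially"
      using \<theta>0 K0 \<kappa>0 B0
      by (auto intro!: order_tendstoD(2)[OF \<alpha>0] order_tendstoD(2)[OF b_lim] divide_pos_pos add_nonneg_pos)
    with \<alpha>1 eventually_ge_at_top[of "2 * \<tau>"]
    have "eventually (\<lambda>n. \<eta> \<le> V n \<longrightarrow> V (Suc n) \<le> V n - \<theta> * \<alpha> n) sequentially"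
    proof eventually_elim
      case (elim n)
      have step: "V (Suc n) \<le> V n - 3/4 * (r n)\<^sup>2 - S n / 2 + 2 * \<alpha> n * E n"
        using elim by (intro V_step) auto
      show ?case
      proof
        assume Vn: "\<eta> \<le> V n"
        show "V (Suc n) \<le> V n - \<theta> * \<alpha> n"
        proof (cases "r n \<le> \<rho> \<and> S n \<le> \<sigma>")
          \<comment> \<open>Nearly feasible, so the excess of \<open>f\<close> drives the descent.\<close>
          case True
          have "\<eta>/2 \<le> (norm (y n - z))\<^sup>2"
            using Vn True by (simp add: V_def \<sigma>_def)
          then have 1: "f z + \<theta> \<le> f (y n)"
            using True \<theta>[OF yR] by (simp add: \<rho>_def r_def)
          have "K * r n \<le> K * (\<theta> / (8 * K))"
            using True K0 by (intro mult_left_mono) (auto simp: \<rho>_def)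
          then have 2: "K * r n \<le> \<theta> / 8" using K0 by simp
          have "sqrt (S n) \<le> \<theta> / (16 * K * (L + 1))"
            using True K0 L0 \<theta>0 by (intro real_le_lsqrt) (auto simp: \<sigma>_def)
          then have "L * sqrt (S n) \<le> (L + 1) * (\<theta> / (16 * K * (L + 1)))"
            using L0 S0[of n] by (intro mult_mono) auto
          then have "L * sqrt (S n) \<le> \<theta> / (16 * K)" using L0 by simp
          then have "norm (w n - T (y n)) \<le> \<theta> / (8 * K)"
            using gap[OF elim(2)] elim(5) by simp
          then have "2 * K * norm (w n - T (y n)) \<le> 2 * K * (\<theta> / (8 * K))"
            using K0 by (intro mult_left_mono) auto
          then have 3: "2 * K * norm (w n - T (y n)) \<le> \<theta> / 4" using K0 by simp
          have 4: "\<alpha> n * K\<^sup>2 \<le> \<theta> / 8"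
            using elim(3) K0 by (simp add: field_simps)
          have "E n \<le> - \<theta> / 2" unfolding E_def using 1 2 3 4 by linarith
          then have "2 * \<alpha> n * E n \<le> 2 * \<alpha> n * (- \<theta> / 2)"
            using \<alpha>[of n] by (intro mult_left_mono) auto
          then have "2 * \<alpha> n * E n \<le> - (\<theta> * \<alpha> n)" by (simp add: mult.commute)
          then show ?thesis
            using step S0[of n] zero_le_power2[of "r n"] by linarith
        next
          \<comment> \<open>A present or recent large residual yields a drop \<open>\<kappa>\<close> independent of \<open>\<alpha> n\<close>.\<close>
          case False
          have \<kappa>: "\<kappa> \<le> 3/4 * \<rho>\<^sup>2" "\<kappa> \<le> \<sigma>/2" by (simp_all add: \<kappa>_def)
          have "\<kappa> \<le> 3/4 * (r n)\<^sup>2 + S n / 2"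
          proof (cases "r n \<le> \<rho>")
            case True
            then have "\<sigma> < S n" using False by simp
            then show ?thesis using \<kappa>(2) zero_le_power2[of "r n"] by linarith
          next
            case False
            then have "\<rho>\<^sup>2 \<le> (r n)\<^sup>2" using \<rho>0 by (intro power_mono) auto
            then show ?thesis using S0[of n] \<kappa>(1) by linarith
          qed
          moreover have "2 * \<alpha> n * E n \<le> 2 * \<alpha> n * B"
            using E_le[OF elim(1)] \<alpha>[of n] by (intro mult_left_mono) auto
          moreover have "2 * \<alpha> n * B + \<theta> * \<alpha> n \<le> \<kappa>"
          proof -
            have "\<alpha> n * (2 * B + \<theta>) \<le> \<kappa>"
              using elim(4) B0 \<theta>0 by (simp add: pos_less_divide_eq)
            then show ?thesis by (simp add: algebra_simps)
          qed
          ultimately show ?thesis using step by linarith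
        qed
      qed
    qed
    with \<theta>0 show "\<exists>\<delta>>0. eventually (\<lambda>n. \<eta> \<le> V n \<longrightarrow> V (Suc n) \<le> V n - \<delta> * \<alpha> n) sequentially"
      by blast
  qed (use V0 div \<alpha> in auto)
  then have "(\<lambda>n. (norm (y n - z))\<^sup>2) \<longlonglongrightarrow> 0"
    by (rule tendsto_sandwich[OF _ _ tendsto_const, rotated 2])
      (use S0 in \<open>auto simp: V_def\<close>)
  then have "(\<lambda>n. norm (y n - z)) \<longlonglongrightarrow> 0"
    using tendsto_real_sqrt by fastforce
  then show ?thesis
    using LIM_zero_cancel tendsto_norm_zero_iff by blast
qed

theorem corollary3p11:
  fixes f :: "real ^ 'd \<Rightarrow> real"
    and T :: "real ^ 'd \<Rightarrow> real ^ 'd"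
    and g :: "real ^ 'd \<Rightarrow> real ^ 'd"
    and \<tau> :: nat
    and delay :: "nat \<Rightarrow> nat"
    and \<alpha> :: "nat \<Rightarrow> real"
    and x :: "int \<Rightarrow> real ^ 'd"
  assumes "strictly_convex_on UNIV f"
    and "firmly_nonexpansive T"
    and "Fix T \<noteq> {}"
    and "minimizers f (Fix T) \<noteq> {}"
    and "\<And>y. g y \<in> subdifferential f y"
    and "\<And>n. delay n \<le> \<tau>"
    and "\<And>n. 0 < \<alpha> n"
    and "\<alpha> \<longlonglongrightarrow> 0"
    and "filterlim (\<lambda>N. \<Sum>n<N. \<alpha> n) at_top sequentially"
    and "fixed_point_delayed_subgradient T g \<tau> delay \<alpha> x"
    and "\<exists>M>0. \<forall>n::nat. norm (x (int n)) \<le> M"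
  shows "\<exists>z. minimizers f (Fix T) = {z} \<and> (\<lambda>n::nat. x (int n)) \<longlonglongrightarrow> z"
proof -
  obtain z where z: "z \<in> minimizers f (Fix T)" using assms(4) by auto
  have only: "p = z" if "p \<in> minimizers f (Fix T)" for p
    by (rule strictly_convex_minimizers_Fix_unique[OF assms(1,2) that z])
  have zF: "z \<in> Fix T" and least: "\<And>u. u \<in> Fix T \<Longrightarrow> f z \<le> f u"
    using z by (auto simp: minimizers_def is_arg_min_linorder)
  have unique: "u = z" if "u \<in> Fix T" "f u \<le> f z" for u
    by (rule only) (use that least in \<open>force simp: minimizers_def is_arg_min_linorder\<close>)
  have cont: "continuous_on UNIV f"
    by (rule convex_on_continuous[OF open_UNIV strictly_convex_on_imp_convex_on[OF assms(1)]])
  have rec: "x (int (Suc n)) = T (x (int n)) - \<alpha> n *\<^sub>R g (T (x (int (n - delay n))))"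
    if "n \<ge> \<tau>" for n
  proof -
    have "int n - int (delay n) = int (n - delay n)"
      using assms(6)[of n] that by simp
    then show ?thesis
      using assms(10) unfolding fixed_point_delayed_subgradient_def
      by (metis of_nat_Suc add.commute)
  qed
  obtain M where M: "\<And>n. norm (x (int n)) \<le> M" using assms(11) by auto
  have "(\<lambda>n. x (int n)) \<longlonglongrightarrow> z"
    using bounded_delayed_subgradient_iterates_tendsto[where y = "\<lambda>n. x (int n)",
        OF cont assms(2) zF unique assms(5-9) rec M] by simp
  with z only show ?thesis by blast
qed

end
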